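(* Let $p,q\ge 1$, let $A$ be a Hermitian $p\times p$ complex matrix, $B$ a Hermitian $q\times q$ complex matrix, and $X$ an arbitrary $q\times p$ complex matrix. Then $$\left\|\begin{pmatrix} A & X^*\\ X & B\end{pmatrix}\right\|_{\infty}\le \max\left\{\, \big\|\,|A|+|X|\,\big\|_{\infty}\,,\ \big\|\,|B|+|X^*|\,\big\|_{\infty}\right\}.$$
   Context: $\|\cdot\|_\infty$ denotes the operator norm (largest singular value). For a (possibly rectangular) complex matrix $Y$, $|Y|=(Y^*Y)^{1/2}$, where $Y^*$ is the conjugate transpose. *)

theory Defs
  imports "HOL-Analysis.Analysis"
begin

text \<open>A matrix of type \<open>complex ^ 'n ^ 'm\<close> has rows indexed by \<open>'m\<close> and columns indexed by \<open>'n\<close>.\<close>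

definition conj_transpose :: "complex ^ 'n ^ 'm \<Rightarrow> complex ^ 'm ^ 'n" where
  "conj_transpose Y = (\<chi> i j. cnj (Y $ j $ i))"

definition hermitian :: "complex ^ 'n ^ 'n \<Rightarrow> bool" where
  "hermitian A \<longleftrightarrow> conj_transpose A = A"

definition pos_semidef :: "complex ^ 'n::finite ^ 'n \<Rightarrow> bool" where
  "pos_semidef P \<longleftrightarrow>
     hermitian P \<and> (\<forall>x. (\<Sum>i\<in>UNIV. cnj (x $ i) * (P *v x) $ i) \<in> \<real>\<^sub>\<ge>\<^sub>0)"

text \<open>The description is meaningful for positive semidefinite \<open>M\<close> only: such an \<open>M\<close> has exactly
  one positive semidefinite square root.\<close>

definition psd_sqrt :: "complex ^ 'n::finite ^ 'n \<Rightarrow> complex ^ 'n ^ 'n" where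
  "psd_sqrt M = (THE P. pos_semidef P \<and> P ** P = M)"

definition mat_abs :: "complex ^ 'n::finite ^ 'm::finite \<Rightarrow> complex ^ 'n ^ 'n" where
  "mat_abs Y = psd_sqrt (conj_transpose Y ** Y)"

text \<open>The norm on \<open>complex ^ 'n\<close> is the Euclidean one, so this is the operator norm induced by
  the Euclidean norms, i.e. the largest singular value. (The type's own \<open>norm\<close> on matrices is the
  Frobenius norm.)\<close>

definition op_norm :: "complex ^ 'n::finite ^ 'm::finite \<Rightarrow> real" where
  "op_norm M = onorm ((*v) M)"

definition block_mat ::
  "'a ^ 'p ^ 'p \<Rightarrow> 'a ^ 'q ^ 'p \<Rightarrow> 'a ^ 'p ^ 'q \<Rightarrow> 'a ^ 'q ^ 'q \<Rightarrow> 'a ^ ('p + 'q) ^ ('p + 'q)" where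
  "block_mat A B C D =
     (\<chi> i j. case i of
        Inl k \<Rightarrow> (case j of Inl l \<Rightarrow> A $ k $ l | Inr l \<Rightarrow> B $ k $ l)
      | Inr k \<Rightarrow> (case j of Inl l \<Rightarrow> C $ k $ l | Inr l \<Rightarrow> D $ k $ l))"

end

theory Submission
  imports Defs
begin

text \<open>
  Write \<open>H\<close> for the block matrix and \<open>z = (x, y)\<close> for a vector. Since \<open>H\<close> is Hermitian, its operator
  norm is the supremum of \<open>\<bar>\<langle>z, H z\<rangle>\<bar>\<close> over unit vectors, so it is enough to bound the quadratic form

  \<open>\<langle>z, H z\<rangle> = \<langle>x, A x\<rangle> + 2 Re \<langle>y, X x\<rangle> + \<langle>y, B y\<rangle>\<close>.

  All three terms are controlled by one principle: if \<open>f\<close> is self-adjoint, \<open>p\<close> is positive semidefinite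
  and \<open>\<parallel>f z\<parallel> \<le> \<parallel>p z\<parallel>\<close> for all \<open>z\<close>, then \<open>\<bar>\<langle>z, f z\<rangle>\<bar> \<le> \<langle>z, p z\<rangle>\<close> (\<open>abs_form_le_of_norm_le\<close>; this is
  operator monotonicity of the square root). With \<open>f = A\<close>, \<open>p = |A|\<close> it gives
  \<open>\<bar>\<langle>x, A x\<rangle>\<bar> \<le> \<langle>x, |A| x\<rangle>\<close>, and similarly for \<open>B\<close>. With \<open>f (x, y) = (X\<^sup>* y, X x)\<close> and
  \<open>p (x, y) = (|X| x, |X\<^sup>*| y)\<close> it gives \<open>2 \<bar>Re \<langle>y, X x\<rangle>\<bar> \<le> \<langle>x, |X| x\<rangle> + \<langle>y, |X\<^sup>*| y\<rangle>\<close>. Summing up,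

  \<open>\<bar>\<langle>z, H z\<rangle>\<bar> \<le> \<langle>x, (|A| + |X|) x\<rangle> + \<langle>y, (|B| + |X\<^sup>*|) y\<rangle>\<close>,

  and the right-hand side is at most \<open>max {\<parallel>|A| + |X|\<parallel>, \<parallel>|B| + |X\<^sup>*|\<parallel>} (\<parallel>x\<parallel>\<^sup>2 + \<parallel>y\<parallel>\<^sup>2)\<close>.

  To use \<open>|Y|\<close> at all, one has to know that \<open>Y\<^sup>* Y\<close> has exactly one positive semidefinite square root.
  Uniqueness is another application of the same principle. Existence is obtained from Brouwer's fixed
  point theorem (\<open>square_root_exists\<close>), which replaces the usual spectral decomposition.

  The inner product \<open>x \<bullet> y\<close> on complex vectors is the real one, \<open>Re \<langle>x, y\<rangle>\<close>. A Hermitian matrix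
  is self-adjoint for it, and its quadratic form is real anyway, so nothing is lost by arguing in
  real Euclidean spaces.
\<close>

section \<open>Hermitian and positive semidefinite matrices\<close>

lemma inner_complex_vec: "x \<bullet> y = Re (\<Sum>i\<in>UNIV. cnj (x $ i) * y $ i)"
  by (simp add: inner_vec_def inner_complex_def)

lemma inner_conj_transpose:
  fixes Y :: "complex ^ 'n::finite ^ 'm::finite"
  shows "(Y *v x) \<bullet> y = x \<bullet> (conj_transpose Y *v y)"
proof -
  have "(\<Sum>i\<in>UNIV. cnj ((Y *v x) $ i) * y $ i)
      = (\<Sum>i\<in>UNIV. \<Sum>j\<in>UNIV. cnj (x $ j) * (cnj (Y $ i $ j) * y $ i))"
    by (simp add: matrix_vector_mult_def sum_distrib_right sum_distrib_left mult_ac)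
  also have "\<dots> = (\<Sum>j\<in>UNIV. cnj (x $ j) * (conj_transpose Y *v y) $ j)"
    by (subst sum.swap)
      (simp add: matrix_vector_mult_def sum_distrib_left conj_transpose_def)
  finally show ?thesis by (simp only: inner_complex_vec)
qed

lemma conj_transpose_conj_transpose [simp]: "conj_transpose (conj_transpose Y) = Y"
  by (simp add: conj_transpose_def vec_eq_iff)

lemma conj_transpose_mult:
  fixes Y :: "complex ^ 'n::finite ^ 'm" and Z :: "complex ^ 'k ^ 'n"
  shows "conj_transpose (Y ** Z) = conj_transpose Z ** conj_transpose Y"
  by (simp add: conj_transpose_def vec_eq_iff matrix_matrix_mult_def mult.commute)

lemma conj_transpose_linear: "linear conj_transpose"
  by (rule linearI) (simp_all add: conj_transpose_def vec_eq_iff)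

lemma scaleR_matrix_vector_mult:
  fixes A :: "complex ^ 'n::finite ^ 'm::finite"
  shows "(c *\<^sub>R A) *v x = c *\<^sub>R (A *v x)"
  by (simp add: vec_eq_iff matrix_vector_mult_def scaleR_sum_right)

text \<open>Positive semidefiniteness requires the complex number \<open>\<langle>x, P x\<rangle>\<close> to be real and nonnegative.
  For Hermitian \<open>P\<close> it equals its own conjugate, so only its real part, \<open>x \<bullet> (P *v x)\<close>, matters.\<close>
lemma pos_semidef_iff_inner:
  "pos_semidef P \<longleftrightarrow> hermitian P \<and> (\<forall>x. 0 \<le> x \<bullet> (P *v x))"
proof -
  have "(\<Sum>i\<in>UNIV. cnj (x $ i) * (P *v x) $ i) \<in> \<real>\<^sub>\<ge>\<^sub>0 \<longleftrightarrow> 0 \<le> x \<bullet> (P *v x)"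
    if P: "hermitian P" for x
  proof -
    define S where "S = (\<Sum>i\<in>UNIV. cnj (x $ i) * (P *v x) $ i)"
    have P': "cnj (P $ i $ j) = P $ j $ i" for i j
    proof -
      have "P $ j $ i = conj_transpose P $ j $ i" using P by (simp add: hermitian_def)
      then show ?thesis by (simp add: conj_transpose_def)
    qed
    have "cnj S = (\<Sum>i\<in>UNIV. \<Sum>j\<in>UNIV. x $ i * (P $ j $ i * cnj (x $ j)))"
      by (simp add: S_def matrix_vector_mult_def sum_distrib_left P')
    also have "\<dots> = S"
      by (subst sum.swap) (simp add: S_def matrix_vector_mult_def sum_distrib_left mult_ac)
    finally have "Im S = 0" by (simp add: complex_eq_iff)
    moreover have "Re S = x \<bullet> (P *v x)"
      unfolding S_def by (rule inner_complex_vec[symmetric])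
    ultimately show ?thesis by (simp add: complex_nonneg_Reals_iff flip: S_def)
  qed
  then show ?thesis by (auto simp: pos_semidef_def)
qed

section \<open>Quadratic forms of self-adjoint operators\<close>

definition self_adjoint :: "('a::real_inner \<Rightarrow> 'a) \<Rightarrow> bool" where
  "self_adjoint f \<longleftrightarrow> linear f \<and> (\<forall>x y. f x \<bullet> y = x \<bullet> f y)"

lemma self_adjoint_linear: "self_adjoint f \<Longrightarrow> linear f"
  by (simp add: self_adjoint_def)

lemma self_adjoint_inner: "self_adjoint f \<Longrightarrow> f x \<bullet> y = x \<bullet> f y"
  by (simp add: self_adjoint_def)

lemma self_adjoint_diff:
  assumes "self_adjoint f" "self_adjoint g"
  shows "self_adjoint (\<lambda>x. f x - g x)"
  using assms by (auto simp: self_adjoint_def inner_diff_left inner_diff_right intro: linear_compose_sub)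

lemma self_adjoint_hermitian: "hermitian A \<Longrightarrow> self_adjoint ((*v) A)"
  by (simp add: self_adjoint_def inner_conj_transpose hermitian_def)

text \<open>A zero of a nonnegative form is a minimum of it, so the derivative of the form, which is
  \<open>2 f x\<close>, vanishes there. Concretely, moving from \<open>x\<close> a little in the direction \<open>- f x\<close> would
  make the form negative.\<close>
lemma psd_form_zero_imp_zero:
  assumes f: "self_adjoint f" and nonneg: "\<And>z. 0 \<le> z \<bullet> f z" and zero: "x \<bullet> f x = 0"
  shows "f x = 0"
proof (rule ccontr)
  assume "f x \<noteq> 0"
  define w where "w = f x"
  define a where "a = w \<bullet> w"
  define b where "b = w \<bullet> f w"
  have a: "a > 0" using \<open>f x \<noteq> 0\<close> by (simp add: a_def w_def)
  have b: "b \<ge> 0" using nonneg by (simp add: b_def)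
  have *: "0 \<le> s\<^sup>2 * b - 2 * s * a" for s
  proof -
    have "f (x - s *\<^sub>R w) = w - s *\<^sub>R f w"
      by (simp add: linear_diff[OF self_adjoint_linear[OF f]]
            linear_scale[OF self_adjoint_linear[OF f]] w_def)
    moreover have "x \<bullet> f w = a" using self_adjoint_inner[OF f, of x w] by (simp add: w_def a_def)
    moreover have "x \<bullet> w = 0" using zero by (simp add: w_def)
    ultimately have "(x - s *\<^sub>R w) \<bullet> f (x - s *\<^sub>R w) = s\<^sup>2 * b - 2 * s * a"
      by (simp add: inner_diff_left inner_diff_right a_def b_def power2_eq_square)
        (simp add: algebra_simps)
    then show ?thesis using nonneg by metis
  qed
  \<comment> \<open>The parabola in \<open>s\<close> is negative for every \<open>0 < s < 2 a / b\<close>; the \<open>+ 1\<close> covers \<open>b = 0\<close>.\<close>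
  define s where "s = a / (b + 1)"
  have s: "s > 0" using a b by (simp add: s_def)
  have "s * b \<le> a" using a b by (simp add: s_def field_simps)
  then have "s * (s * b) \<le> s * a" using s by simp
  moreover have "0 < s * a" using s a by simp
  moreover have "s\<^sup>2 * b = s * (s * b)" by (simp add: power2_eq_square)
  ultimately show False using *[of s] by linarith
qed

text \<open>By compactness the form attains its minimum \<open>m\<close> on the unit sphere. Then \<open>f - m\<close> has a
  nonnegative form that vanishes at the minimizer, which is therefore an eigenvector.\<close>
lemma negative_form_imp_negative_eigenvalue:
  fixes f :: "'a::euclidean_space \<Rightarrow> 'a"
  assumes f: "self_adjoint f" and neg: "z \<bullet> f z < 0"
  obtains x m where "x \<noteq> 0" "m < 0" "f x = m *\<^sub>R x"
proof -
  note lin = self_adjoint_linear[OF f]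
  have z0: "z \<noteq> 0" using neg by auto
  have "continuous_on (sphere 0 1) (\<lambda>x. x \<bullet> f x)"
    by (intro continuous_intros linear_continuous_on linear_conv_bounded_linear[THEN iffD1] lin)
  moreover have "sgn z \<in> sphere 0 1" using z0 by (simp add: norm_sgn)
  ultimately obtain x where x: "x \<in> sphere 0 1" and le: "\<And>y. y \<in> sphere 0 1 \<Longrightarrow> x \<bullet> f x \<le> y \<bullet> f y"
    using continuous_attains_inf[OF compact_sphere, of "0::'a" 1 "\<lambda>x. x \<bullet> f x"] by blast
  define m where "m = x \<bullet> f x"
  have form: "y \<bullet> f y = (norm y)\<^sup>2 * (sgn y \<bullet> f (sgn y))" if "y \<noteq> 0" for y
  proof -
    have "y \<bullet> f y = (norm y *\<^sub>R sgn y) \<bullet> f (norm y *\<^sub>R sgn y)"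
      using that by (simp add: sgn_div_norm)
    then show ?thesis by (simp only: linear_scale[OF lin] inner_scaleR_left inner_scaleR_right
          power2_eq_square mult.assoc)
  qed
  have ge: "m * (norm y)\<^sup>2 \<le> y \<bullet> f y" for y
  proof (cases "y = 0")
    case False
    then have "m \<le> sgn y \<bullet> f (sgn y)" using le[of "sgn y"] by (simp add: m_def norm_sgn)
    then have "(norm y)\<^sup>2 * m \<le> (norm y)\<^sup>2 * (sgn y \<bullet> f (sgn y))" by (intro mult_left_mono) auto
    then show ?thesis using form[OF False] by (simp add: mult.commute)
  qed (simp add: linear_0[OF lin])
  have "self_adjoint (\<lambda>y. m *\<^sub>R y)"
    by (simp add: self_adjoint_def linear_scaleR)
  then have g: "self_adjoint (\<lambda>y. f y - m *\<^sub>R y)" by (rule self_adjoint_diff[OF f])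
  have "f x - m *\<^sub>R x = 0"
    using x ge by (intro psd_form_zero_imp_zero[OF g])
      (auto simp: inner_diff_right dot_square_norm m_def[symmetric])
  then have "f x = m *\<^sub>R x" by simp
  moreover have "m < 0"
  proof (rule ccontr)
    assume "\<not> m < 0"
    then have "0 \<le> m * (norm z)\<^sup>2" by simp
    then show False using ge[of z] neg by linarith
  qed
  moreover have "x \<noteq> 0" using x by auto
  ultimately show thesis using that by blast
qed

text \<open>The norm of a self-adjoint operator equals its numerical radius: polarization bounds
  \<open>w \<bullet> f z\<close> by the form at \<open>z + w\<close> and \<open>z - w\<close>, and the parallelogram law turns this into
  \<open>2 (w \<bullet> f z) \<le> c (\<parallel>z\<parallel>\<^sup>2 + \<parallel>w\<parallel>\<^sup>2)\<close>. The best \<open>w\<close> is parallel to \<open>f z\<close> and as long as \<open>z\<close>.\<close>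
lemma norm_le_of_abs_form_le:
  assumes f: "self_adjoint f" and le: "\<And>z. \<bar>z \<bullet> f z\<bar> \<le> c * (norm z)\<^sup>2"
  shows "norm (f z) \<le> c * norm z"
proof (cases "f z = 0")
  case True
  show ?thesis
  proof (cases "z = 0")
    case False
    have "0 \<le> c * (norm z)\<^sup>2" using le[of z] by linarith
    then have "0 \<le> c" using False by (simp add: zero_le_mult_iff)
    then show ?thesis using True by simp
  qed (use True in simp)
next
  case False
  note lin = self_adjoint_linear[OF f]
  then have z: "z \<noteq> 0" using False linear_0[OF lin] by auto
  define w where "w = (norm z / norm (f z)) *\<^sub>R f z"
  have nw: "norm w = norm z" using False by (simp add: w_def)
  have wf: "w \<bullet> f z = norm z * norm (f z)"
    using False by (simp add: w_def dot_square_norm power2_eq_square)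
  have "z \<bullet> f w = w \<bullet> f z" using self_adjoint_inner[OF f, of z w] by (simp add: inner_commute)
  then have "4 * (w \<bullet> f z) = (z + w) \<bullet> f (z + w) - (z - w) \<bullet> f (z - w)"
    by (simp add: linear_add[OF lin] linear_diff[OF lin] inner_add_left inner_add_right
        inner_diff_left inner_diff_right)
  also have "\<dots> \<le> c * (norm (z + w))\<^sup>2 + c * (norm (z - w))\<^sup>2"
    using le[of "z + w"] le[of "z - w"] by linarith
  also have "\<dots> = 2 * c * ((norm z)\<^sup>2 + (norm w)\<^sup>2)"
    by (simp add: power2_norm_eq_inner inner_add_left inner_add_right
        inner_diff_left inner_diff_right inner_commute algebra_simps)
  finally have "norm z * norm (f z) \<le> norm z * (c * norm z)"
    by (simp add: nw wf power2_eq_square mult_ac)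
  then show ?thesis using z by simp
qed

text \<open>If \<open>z \<bullet> f z > z \<bullet> p z\<close> for some \<open>z\<close>, then \<open>p - f\<close> has an eigenvector \<open>x\<close> with eigenvalue \<open>m < 0\<close>. So
  \<open>f x\<close> is \<open>p x\<close> plus a positive multiple of \<open>x\<close>; since \<open>x \<bullet> p x \<ge> 0\<close>, this makes \<open>f x\<close>
  strictly longer than \<open>p x\<close>. The same applies to \<open>- f\<close>.\<close>
lemma abs_form_le_of_norm_le:
  fixes f p :: "'a::euclidean_space \<Rightarrow> 'a"
  assumes f: "self_adjoint f" and p: "self_adjoint p"
    and nonneg: "\<And>z. 0 \<le> z \<bullet> p z" and le: "\<And>z. norm (f z) \<le> norm (p z)"
  shows "\<bar>z \<bullet> f z\<bar> \<le> z \<bullet> p z"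
proof -
  have "z \<bullet> g z \<le> z \<bullet> p z" if g: "self_adjoint g" and g_le: "\<And>z. norm (g z) \<le> norm (p z)" for g
  proof (rule ccontr)
    assume "\<not> ?thesis"
    then have "z \<bullet> (p z - g z) < 0" by (simp add: inner_diff_right)
    then obtain x m where x: "x \<noteq> 0" and m: "m < 0" and eq: "p x - g x = m *\<^sub>R x"
      using negative_form_imp_negative_eigenvalue[OF self_adjoint_diff[OF p g]] by blast
    have gx: "g x = p x - m *\<^sub>R x" using eq by (simp add: algebra_simps)
    have "(norm (g x))\<^sup>2 = (norm (p x))\<^sup>2 - 2 * m * (x \<bullet> p x) + m\<^sup>2 * (norm x)\<^sup>2"
      unfolding gx power2_norm_eq_inner
      by (simp add: inner_diff_left inner_diff_right inner_commute power2_eq_square)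
    moreover have "0 < m\<^sup>2 * (norm x)\<^sup>2" using m x by simp
    moreover have "m * (x \<bullet> p x) \<le> 0" using m nonneg[of x] by (simp add: mult_nonpos_nonneg)
    moreover have "(norm (g x))\<^sup>2 \<le> (norm (p x))\<^sup>2" using g_le by (simp add: power_mono)
    ultimately show False by linarith
  qed
  from this[of f] this[of "\<lambda>z. - f z"] f le show ?thesis
    by (simp add: self_adjoint_def linear_compose_neg)
qed

section \<open>Positive semidefinite square roots\<close>

definition hermitian_contractions :: "(complex ^ 'n::finite ^ 'n) set" where
  "hermitian_contractions = {Z. hermitian Z \<and> (\<forall>z. norm (Z *v z) \<le> norm z)}"

lemma matrix_vector_mult_linear_left:
  "linear (\<lambda>Z :: complex ^ 'n::finite ^ 'm::finite. Z *v z)"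
  by (rule linearI) (simp_all add: matrix_vector_mult_add_rdistrib scaleR_matrix_vector_mult)

lemma convex_hermitian_contractions:
  "convex (hermitian_contractions :: (complex ^ 'n::finite ^ 'n) set)"
proof (rule convexI)
  fix U V :: "complex ^ 'n ^ 'n" and u v :: real
  assume U: "U \<in> hermitian_contractions" and V: "V \<in> hermitian_contractions"
    and uv: "0 \<le> u" "0 \<le> v" "u + v = 1"
  have "norm ((u *\<^sub>R U + v *\<^sub>R V) *v z) \<le> norm z" for z
  proof -
    have "norm ((u *\<^sub>R U + v *\<^sub>R V) *v z) \<le> u * norm (U *v z) + v * norm (V *v z)"
      using uv norm_triangle_ineq[of "u *\<^sub>R (U *v z)" "v *\<^sub>R (V *v z)"]
      by (simp add: matrix_vector_mult_add_rdistrib scaleR_matrix_vector_mult)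
    also have "\<dots> \<le> u * norm z + v * norm z"
      using U V uv by (intro add_mono mult_left_mono) (auto simp: hermitian_contractions_def)
    also have "\<dots> = norm z" using uv by (simp flip: distrib_right)
    finally show ?thesis .
  qed
  then show "u *\<^sub>R U + v *\<^sub>R V \<in> hermitian_contractions"
    using U V by (simp add: hermitian_contractions_def hermitian_def linear_add[OF conj_transpose_linear]
        linear_scale[OF conj_transpose_linear])
qed

lemma compact_hermitian_contractions:
  "compact (hermitian_contractions :: (complex ^ 'n::finite ^ 'n) set)"
  (is "compact ?S")
proof (rule compact_eq_bounded_closed[THEN iffD2], intro conjI)
  have "norm Z \<le> real CARD('n) * real CARD('n)" if "Z \<in> ?S" for Z
  proof -
    have "norm (Z $ i $ j) \<le> 1" for i j
    proof -
      have "Z $ i $ j = (Z *v axis j 1) $ i"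
        by (simp add: matrix_vector_mult_def axis_def if_distrib[of "\<lambda>u. _ * u"] cong: if_cong)
      also have "norm \<dots> \<le> norm (Z *v axis j 1)" by (rule Finite_Cartesian_Product.norm_nth_le)
      also have "\<dots> \<le> 1" using that by (auto simp: hermitian_contractions_def intro: order_trans)
      finally show ?thesis .
    qed
    then have "(\<Sum>i\<in>UNIV. \<Sum>j\<in>UNIV. norm (Z $ i $ j)) \<le> (\<Sum>i\<in>(UNIV::'n set). \<Sum>j\<in>(UNIV::'n set). 1)"
      by (intro sum_mono)
    moreover have "norm Z \<le> (\<Sum>i\<in>UNIV. \<Sum>j\<in>UNIV. norm (Z $ i $ j))"
      unfolding norm_vec_def
      by (intro order_trans[OF L2_set_le_sum] sum_mono) (auto simp: L2_set_le_sum norm_vec_def)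
    ultimately show ?thesis by simp
  qed
  then show "bounded ?S" by (auto simp: bounded_iff)
  have "?S = {Z. conj_transpose Z = Z} \<inter> (\<Inter>z. {Z. norm (Z *v z) \<le> norm z})"
    by (auto simp: hermitian_contractions_def hermitian_def)
  also have "closed \<dots>"
    by (intro closed_Int closed_INT ballI closed_Collect_eq closed_Collect_le continuous_intros
        linear_continuous_on linear_conv_bounded_linear[THEN iffD1]
        matrix_vector_mult_linear_left conj_transpose_linear)
  finally show "closed ?S" .
qed

text \<open>A product of contractions is a contraction, and the square of a Hermitian matrix is Hermitian.
  So \<open>Z \<mapsto> (N + Z\<^sup>2) / 2\<close> maps the compact convex set of Hermitian contractions into itself, and
  Brouwer's theorem provides a fixed point.\<close>
lemma quadratic_fixed_point:
  fixes N :: "complex ^ 'n::finite ^ 'n"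
  assumes N: "N \<in> hermitian_contractions"
  obtains Z where "Z \<in> hermitian_contractions" "(1 / 2) *\<^sub>R (N + Z ** Z) = Z"
proof -
  let ?S = "hermitian_contractions :: (complex ^ 'n ^ 'n) set"
  define \<Phi> where "\<Phi> Z = (1 / 2) *\<^sub>R (N + Z ** Z)" for Z
  have \<Phi>_vec: "\<Phi> Z *v z = (1 / 2) *\<^sub>R (N *v z + Z *v (Z *v z))" for Z z
    by (simp add: \<Phi>_def scaleR_matrix_vector_mult matrix_vector_mult_add_rdistrib
        matrix_vector_mul_assoc)
  have "?S \<noteq> {}" using N by auto
  moreover have "continuous_on ?S \<Phi>"
    unfolding \<Phi>_def matrix_matrix_mult_def by (intro continuous_intros)
  moreover have "\<Phi> \<in> ?S \<rightarrow> ?S"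
  proof
    fix Z assume Z: "Z \<in> ?S"
    have "norm (\<Phi> Z *v z) \<le> norm z" for z
    proof -
      have N_le: "norm (N *v z) \<le> norm z" using N by (simp add: hermitian_contractions_def)
      have "norm (Z *v (Z *v z)) \<le> norm z"
        using Z by (auto simp: hermitian_contractions_def intro: order_trans)
      then show ?thesis
        using N_le norm_triangle_ineq[of "N *v z" "Z *v (Z *v z)"] by (simp add: \<Phi>_vec)
    qed
    moreover have "hermitian (\<Phi> Z)"
      using Z N by (simp add: hermitian_contractions_def hermitian_def \<Phi>_def linear_add[OF conj_transpose_linear]
          linear_scale[OF conj_transpose_linear] conj_transpose_mult)
    ultimately show "\<Phi> Z \<in> ?S" by (simp add: hermitian_contractions_def)
  qed
  ultimately obtain Z where "Z \<in> ?S" "\<Phi> Z = Z"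
    by (rule brouwer[OF compact_hermitian_contractions convex_hermitian_contractions])
  then show thesis using that by (simp add: \<Phi>_def)
qed

text \<open>Put \<open>M = Y\<^sup>* Y\<close> and choose \<open>c > 0\<close> so large that \<open>N = 1 - M / c\<close> is a contraction. A root of
  the form \<open>\<surd>c (1 - Z)\<close> requires \<open>(1 - Z)\<^sup>2 = 1 - N\<close>, that is, \<open>Z = (N + Z\<^sup>2) / 2\<close>, so a fixed point
  as above yields one. As \<open>Z\<close> is a contraction, \<open>1 - Z\<close> is positive semidefinite.\<close>
lemma square_root_exists:
  fixes Y :: "complex ^ 'n::finite ^ 'm::finite"
  shows "\<exists>P. pos_semidef P \<and> P ** P = conj_transpose Y ** Y"
proof -
  define M where "M = conj_transpose Y ** Y"
  \<comment> \<open>The square bounds \<open>\<parallel>M z\<parallel>\<^sup>2 = \<parallel>Y\<^sup>* Y z\<parallel>\<^sup>2\<close> in terms of \<open>\<parallel>Y z\<parallel>\<^sup>2 = z \<bullet> M z\<close>;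
    adding 1 keeps \<open>c\<close> positive when \<open>Y = 0\<close>.\<close>
  define c where "c = (onorm ((*v) (conj_transpose Y)))\<^sup>2 + 1"
  define N where "N = mat 1 - (1 / c) *\<^sub>R M"
  have c: "c > 0" by (simp add: c_def add_nonneg_pos)
  have M_vec: "M *v z = conj_transpose Y *v (Y *v z)" for z
    by (simp add: M_def matrix_vector_mul_assoc)
  have N_vec: "N *v z = z - (1 / c) *\<^sub>R (M *v z)" for z
    by (simp add: N_def matrix_vector_mult_diff_rdistrib scaleR_matrix_vector_mult)
  have "hermitian M" by (simp add: hermitian_def M_def conj_transpose_mult)
  moreover have "conj_transpose (mat 1 :: complex ^ 'n ^ 'n) = mat 1"
    by (auto simp: conj_transpose_def mat_def vec_eq_iff)
  ultimately have N_herm: "hermitian N"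
    by (simp add: hermitian_def N_def linear_diff[OF conj_transpose_linear]
        linear_scale[OF conj_transpose_linear])
  have N_le: "norm (N *v z) \<le> norm z" for z
  proof -
    have "norm (M *v z) \<le> onorm ((*v) (conj_transpose Y)) * norm (Y *v z)"
      unfolding M_vec by (rule onorm[OF matrix_vector_mul_bounded_linear])
    then have "(norm (M *v z))\<^sup>2 \<le> (onorm ((*v) (conj_transpose Y)) * norm (Y *v z))\<^sup>2"
      by (rule power_mono) simp
    also have "\<dots> \<le> c * (norm (Y *v z))\<^sup>2"
      by (simp add: c_def power_mult_distrib mult_right_mono)
    finally have M_le: "(norm (M *v z))\<^sup>2 \<le> c * (norm (Y *v z))\<^sup>2" .
    have "z \<bullet> (M *v z) = (norm (Y *v z))\<^sup>2"
      by (simp add: M_vec inner_conj_transpose[symmetric] power2_norm_eq_inner)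
    then have "(norm (N *v z))\<^sup>2 = (norm z)\<^sup>2 - 2 / c * (norm (Y *v z))\<^sup>2 + (norm (M *v z))\<^sup>2 / c\<^sup>2"
      unfolding N_vec power2_norm_eq_inner
      by (simp add: inner_diff_left inner_diff_right inner_commute power2_eq_square)
    also have "(norm (M *v z))\<^sup>2 / c\<^sup>2 \<le> c * (norm (Y *v z))\<^sup>2 / c\<^sup>2"
      using M_le by (intro divide_right_mono) auto
    also have "\<dots> = 1 / c * (norm (Y *v z))\<^sup>2" using c by (simp add: power2_eq_square)
    also have "(norm z)\<^sup>2 - 2 / c * (norm (Y *v z))\<^sup>2 + 1 / c * (norm (Y *v z))\<^sup>2 \<le> (norm z)\<^sup>2"
      using c by (simp add: field_simps)
    finally show ?thesis by (simp add: power2_le_iff_abs_le)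
  qed
  have "N \<in> hermitian_contractions" using N_herm N_le by (simp add: hermitian_contractions_def)
  then obtain Z where Z: "Z \<in> hermitian_contractions" and fix_Z: "(1 / 2) *\<^sub>R (N + Z ** Z) = Z"
    by (rule quadratic_fixed_point)
  define P where "P = sqrt c *\<^sub>R (mat 1 - Z)"
  have P_vec: "P *v z = sqrt c *\<^sub>R (z - Z *v z)" for z
    by (simp add: P_def scaleR_matrix_vector_mult matrix_vector_mult_diff_rdistrib)
  have "hermitian P"
    using Z \<open>conj_transpose (mat 1) = mat 1\<close>
    by (simp add: P_def hermitian_contractions_def hermitian_def linear_diff[OF conj_transpose_linear]
        linear_scale[OF conj_transpose_linear])
  moreover have "0 \<le> z \<bullet> (P *v z)" for z
  proof -
    have "z \<bullet> (Z *v z) \<le> norm z * norm (Z *v z)" by (rule norm_cauchy_schwarz)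
    also have "\<dots> \<le> norm z * norm z" using Z by (intro mult_left_mono) (auto simp: hermitian_contractions_def)
    finally show ?thesis
      using c by (simp add: P_vec inner_diff_right dot_square_norm power2_eq_square)
  qed
  moreover have "P ** P = M"
    unfolding matrix_eq
  proof
    fix z
    have "2 *\<^sub>R (Z *v z) = N *v z + Z *v (Z *v z)"
      using arg_cong[OF fix_Z, of "\<lambda>U. 2 *\<^sub>R U *v z"]
      by (simp add: scaleR_matrix_vector_mult matrix_vector_mult_add_rdistrib matrix_vector_mul_assoc)
    then have *: "(1 / c) *\<^sub>R (M *v z) = z - 2 *\<^sub>R (Z *v z) + Z *v (Z *v z)"
      unfolding N_vec by (simp add: algebra_simps)
    have "M *v z = c *\<^sub>R ((1 / c) *\<^sub>R (M *v z))" using c by simp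
    also have "\<dots> = c *\<^sub>R (z - 2 *\<^sub>R (Z *v z) + Z *v (Z *v z))" by (simp only: *)
    also have "\<dots> = P *v (P *v z)"
      using c by (simp add: P_vec linear_scale[OF matrix_vector_mul_linear] matrix_vector_mult_diff_distrib
          algebra_simps scaleR_2)
    finally show "(P ** P) *v z = M *v z" by (simp add: matrix_vector_mul_assoc)
  qed
  ultimately show ?thesis by (auto simp: pos_semidef_iff_inner M_def)
qed

lemma norm_mult_square_root:
  assumes P: "hermitian P" and sq: "P ** P = conj_transpose Y ** Y"
  shows "norm (P *v z) = norm (Y *v z)"
proof -
  have "(P *v z) \<bullet> (P *v z) = z \<bullet> ((P ** P) *v z)"
    using self_adjoint_inner[OF self_adjoint_hermitian[OF P]]
    by (simp add: matrix_vector_mul_assoc)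
  also have "\<dots> = (Y *v z) \<bullet> (Y *v z)"
    by (simp add: sq inner_conj_transpose matrix_vector_mul_assoc)
  finally show ?thesis by (simp add: norm_eq_sqrt_inner)
qed

text \<open>The two roots satisfy \<open>\<parallel>P z\<parallel> = \<parallel>Q z\<parallel>\<close>, hence have equal forms by the comparison in both
  directions; a self-adjoint operator with zero form is zero.\<close>
lemma square_root_unique:
  assumes P: "pos_semidef P" and Q: "pos_semidef Q"
    and PQ: "P ** P = Q ** Q"
  shows "P = Q"
proof -
  have sa: "self_adjoint ((*v) P)" "self_adjoint ((*v) Q)"
    and ge: "\<And>z. 0 \<le> z \<bullet> (P *v z)" "\<And>z. 0 \<le> z \<bullet> (Q *v z)"
    using P Q by (auto simp: pos_semidef_iff_inner intro: self_adjoint_hermitian)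
  have n: "norm (P *v z) = norm (Q *v z)" for z
    by (rule norm_mult_square_root) (use P Q PQ in \<open>auto simp: pos_semidef_def hermitian_def\<close>)
  have "z \<bullet> (P *v z) = z \<bullet> (Q *v z)" for z
    using abs_form_le_of_norm_le[OF sa(1,2) ge(2), of z]
      abs_form_le_of_norm_le[OF sa(2,1) ge(1), of z] by (simp add: n)
  then have "norm (P *v z - Q *v z) \<le> 0 * norm z" for z
    by (intro norm_le_of_abs_form_le self_adjoint_diff sa) (simp add: inner_diff_right)
  then show ?thesis by (simp add: matrix_eq)
qed

section \<open>Block matrices\<close>

lemma sum_UNIV_Plus:
  fixes g :: "'p::finite + 'q::finite \<Rightarrow> 'a::comm_monoid_add"
  shows "sum g UNIV = (\<Sum>i\<in>UNIV. g (Inl i)) + (\<Sum>i\<in>UNIV. g (Inr i))"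
  unfolding UNIV_Plus_UNIV[symmetric] by (subst sum.Plus) simp_all

lemma inner_block:
  fixes x y :: "complex ^ ('p::finite + 'q::finite)"
  shows "x \<bullet> y = (\<chi> i. x $ Inl i) \<bullet> (\<chi> i. y $ Inl i) + (\<chi> i. x $ Inr i) \<bullet> (\<chi> i. y $ Inr i)"
  by (simp add: inner_vec_def sum_UNIV_Plus)

lemma block_mat_form:
  fixes A :: "complex ^ 'p::finite ^ 'p" and D :: "complex ^ 'q::finite ^ 'q"
  defines "up \<equiv> \<lambda>z :: complex ^ ('p + 'q). \<chi> i. z $ Inl i"
    and "lo \<equiv> \<lambda>z :: complex ^ ('p + 'q). \<chi> i. z $ Inr i"
  shows "z \<bullet> (block_mat A B C D *v z) = up z \<bullet> (A *v up z) + up z \<bullet> (B *v lo z)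
    + lo z \<bullet> (C *v up z) + lo z \<bullet> (D *v lo z)"
proof -
  have "up (block_mat A B C D *v z) = A *v up z + B *v lo z"
    "lo (block_mat A B C D *v z) = C *v up z + D *v lo z"
    by (simp_all add: up_def lo_def block_mat_def matrix_vector_mult_def vec_eq_iff sum_UNIV_Plus)
  then show ?thesis
    using inner_block[of z "block_mat A B C D *v z"]
    by (simp add: up_def lo_def inner_add_right)
qed

lemma hermitian_block_mat:
  assumes "hermitian A" "hermitian B"
  shows "hermitian (block_mat A (conj_transpose X) X B)"
  using assms by (auto simp: hermitian_def conj_transpose_def block_mat_def vec_eq_iff split: sum.split)

section \<open>Absolute values of matrices\<close>

lemma mat_abs_nonneg: "0 \<le> z \<bullet> (mat_abs Y *v z)"
  and self_adjoint_mat_abs: "self_adjoint ((*v) (mat_abs Y))"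
  and norm_mat_abs: "norm (mat_abs Y *v z) = norm (Y *v z)"
proof -
  have "\<exists>!P. pos_semidef P \<and> P ** P = conj_transpose Y ** Y"
    using square_root_exists[of Y] square_root_unique by metis
  from theI'[OF this] have psd: "pos_semidef (mat_abs Y)"
    and square: "mat_abs Y ** mat_abs Y = conj_transpose Y ** Y"
    by (simp_all add: mat_abs_def psd_sqrt_def)
  then show "0 \<le> z \<bullet> (mat_abs Y *v z)" "self_adjoint ((*v) (mat_abs Y))"
    "norm (mat_abs Y *v z) = norm (Y *v z)"
    by (simp_all add: pos_semidef_iff_inner self_adjoint_hermitian norm_mult_square_root)
qed

lemma form_le_op_norm: "z \<bullet> (M *v z) \<le> op_norm M * (norm z)\<^sup>2"
proof -
  have "z \<bullet> (M *v z) \<le> norm z * norm (M *v z)" by (rule norm_cauchy_schwarz)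
  also have "\<dots> \<le> norm z * (onorm ((*v) M) * norm z)"
    by (intro mult_left_mono onorm[OF matrix_vector_mul_bounded_linear]) simp
  finally show ?thesis by (simp add: op_norm_def power2_eq_square mult_ac)
qed

lemma abs_form_le_mat_abs:
  assumes "hermitian A"
  shows "\<bar>z \<bullet> (A *v z)\<bar> \<le> z \<bullet> (mat_abs A *v z)"
  by (rule abs_form_le_of_norm_le)
    (simp_all add: assms self_adjoint_hermitian self_adjoint_mat_abs mat_abs_nonneg norm_mat_abs)

text \<open>On pairs, \<open>f (x, y) = (X\<^sup>* y, X x)\<close> is self-adjoint with form \<open>2 (y \<bullet> X x)\<close>, and
  \<open>p (x, y) = (|X| x, |X\<^sup>*| y)\<close> is positive semidefinite with \<open>\<parallel>p z\<parallel> = \<parallel>f z\<parallel>\<close>. In matrix terms,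
  \<open>p\<close> is the absolute value of the off-diagonal part of the block matrix.\<close>
lemma abs_bilinear_le_mat_abs:
  fixes X :: "complex ^ 'n::finite ^ 'm::finite"
  shows "2 * \<bar>y \<bullet> (X *v x)\<bar> \<le> x \<bullet> (mat_abs X *v x) + y \<bullet> (mat_abs (conj_transpose X) *v y)"
proof -
  define f where "f z = (conj_transpose X *v snd z, X *v fst z)" for z
  define p where "p z = (mat_abs X *v fst z, mat_abs (conj_transpose X) *v snd z)" for z
  note scale = linear_scale[OF matrix_vector_mul_linear]
  have "linear f" "linear p"
    by (rule linearI; simp add: f_def p_def matrix_vector_right_distrib scale)+
  moreover have "f a \<bullet> b = a \<bullet> f b" "p a \<bullet> b = a \<bullet> p b" for a b
    by (simp add: f_def inner_prod_def inner_conj_transpose)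
      (simp add: p_def inner_prod_def self_adjoint_inner[OF self_adjoint_mat_abs])
  ultimately have "self_adjoint f" "self_adjoint p" by (simp_all add: self_adjoint_def)
  then have "\<bar>(x, y) \<bullet> f (x, y)\<bar> \<le> (x, y) \<bullet> p (x, y)"
    by (rule abs_form_le_of_norm_le)
      (simp_all add: f_def p_def norm_Pair norm_mat_abs mat_abs_nonneg inner_prod_def)
  moreover have "x \<bullet> (conj_transpose X *v y) = y \<bullet> (X *v x)"
    by (simp add: inner_conj_transpose[symmetric] inner_commute)
  ultimately show ?thesis by (simp add: f_def p_def)
qed

theorem corollary3p3:
  fixes A :: "complex ^ 'p::finite ^ 'p"
    and B :: "complex ^ 'q::finite ^ 'q"
    and X :: "complex ^ 'p ^ 'q"
  assumes "hermitian A" and "hermitian B"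
  shows "op_norm (block_mat A (conj_transpose X) X B)
           \<le> max (op_norm (mat_abs A + mat_abs X))
                 (op_norm (mat_abs B + mat_abs (conj_transpose X)))"
proof -
  define H where "H = block_mat A (conj_transpose X) X B"
  define P where "P = mat_abs A + mat_abs X"
  define Q where "Q = mat_abs B + mat_abs (conj_transpose X)"
  define c where "c = max (op_norm P) (op_norm Q)"
  have "\<bar>z \<bullet> (H *v z)\<bar> \<le> c * (norm z)\<^sup>2" for z
  proof -
    define x where "x = (\<chi> i. z $ Inl i)"
    define y where "y = (\<chi> i. z $ Inr i)"
    have "x \<bullet> (conj_transpose X *v y) = y \<bullet> (X *v x)"
      by (simp add: inner_conj_transpose[symmetric] inner_commute)
    then have "z \<bullet> (H *v z) = x \<bullet> (A *v x) + 2 * (y \<bullet> (X *v x)) + y \<bullet> (B *v y)"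
      by (simp add: H_def block_mat_form x_def y_def)
    also have "\<bar>\<dots>\<bar> \<le> \<bar>x \<bullet> (A *v x)\<bar> + 2 * \<bar>y \<bullet> (X *v x)\<bar> + \<bar>y \<bullet> (B *v y)\<bar>" by linarith
    also have "\<dots> \<le> x \<bullet> (mat_abs A *v x)
        + (x \<bullet> (mat_abs X *v x) + y \<bullet> (mat_abs (conj_transpose X) *v y)) + y \<bullet> (mat_abs B *v y)"
      by (intro add_mono abs_form_le_mat_abs abs_bilinear_le_mat_abs assms)
    also have "\<dots> = x \<bullet> (P *v x) + y \<bullet> (Q *v y)"
      by (simp add: P_def Q_def matrix_vector_mult_add_rdistrib inner_add_right)
    also have "\<dots> \<le> c * (norm x)\<^sup>2 + c * (norm y)\<^sup>2"
      by (intro add_mono order_trans[OF form_le_op_norm] mult_right_mono) (simp_all add: c_def)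
    also have "\<dots> = c * (norm z)\<^sup>2"
      by (simp add: power2_norm_eq_inner inner_block[of z z] x_def y_def distrib_left)
    finally show ?thesis .
  qed
  then have "norm (H *v z) \<le> c * norm z" for z
    unfolding H_def by (intro norm_le_of_abs_form_le self_adjoint_hermitian hermitian_block_mat assms)
  then have "op_norm H \<le> c"
    unfolding op_norm_def by (rule onorm_le)
  then show ?thesis by (simp only: H_def P_def Q_def c_def)
qed

end
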